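(* (The Inversion Formula) Let $K$ be a commutative ring, $\sigma\in\Gamma\,\mathrm{GL}_n(K)^{op}$ and $a\in\Lambda_n(K)$. Then $$\sigma^{-1}(a)=\sum_{\alpha\subseteq\{1,\dots,n\}}\phi_\sigma\big(\partial'^\alpha(a)\big)x^\alpha,$$ where $x^\alpha=x_1^{\alpha_1}\cdots x_n^{\alpha_n}$ and $\partial'^\alpha=\partial_n'^{\alpha_n}\cdots\partial_1'^{\alpha_1}$ (with $\alpha_i=1$ if $i\in\alpha$ and $\alpha_i=0$ otherwise), and $\phi_\sigma$, $\partial'_i$ are the maps $\Lambda_n\to\Lambda_n$ $$\phi_\sigma=(1-\sigma(x_n)\partial_n')(1-\sigma(x_{n-1})\partial_{n-1}')\cdots(1-\sigma(x_1)\partial_1'),$$ $$\partial_i'=\frac1{\det\left(\frac{\partial\sigma(x_\nu)}{\partial x_\mu}\right)}\det\begin{pmatrix}\frac{\partial\sigma(x_1)}{\partial x_1}&\cdots&\frac{\partial\sigma(x_1)}{\partial x_n}\\\vdots&&\vdots\\\frac{\partial}{\partial x_1}&\cdots&\frac{\partial}{\partial x_n}\\\vdots&&\vdots\\\frac{\partial\sigma(x_n)}{\partial x_1}&\cdots&\frac{\partial\sigma(x_n)}{\partial x_n}\end{pmatrix},\qquad i=1,\dots,n,$$ the second determinant being obtained from the Jacobian matrix $\left(\frac{\partial\sigma(x_\nu)}{\partial x_\mu}\right)$ by replacing its $i$-th row with $\left(\frac\partial{\partial x_1},\dots,\frac\partial{\partial x_n}\right)$.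
   Context: $\Lambda_n=\Lambda_n(K)$ is the Grassmann $K$-algebra generated freely over $K$ by $x_1,\dots,x_n$ subject to $x_i^2=0$, $x_ix_j=-x_jx_i$ ($i\ne j$); it is graded by total degree with components $\Lambda_{n,d}$; $\mathfrak m=\bigoplus_{d\ge1}\Lambda_{n,d}$; $\Lambda_n^{od}$ is the sum of the odd degree components. $\Gamma$ is the group of $K$-algebra automorphisms $\sigma$ of $\Lambda_n$ with $\sigma(x_i)-x_i\in\Lambda_n^{od}\cap\mathfrak m^3$ for all $i$; $\mathrm{GL}_n(K)^{op}=\{\sigma_A\mid A\in\mathrm{GL}_n(K)\}$ with $\sigma_A(x_i)=\sum_ja_{ij}x_j$; $\Gamma\,\mathrm{GL}_n(K)^{op}$ is the group of all products of an element of $\Gamma$ and an element of $\mathrm{GL}_n(K)^{op}$. $\frac{\partial}{\partial x_j}$ is the left skew derivation of $\Lambda_n$: the $K$-linear map with $\frac{\partial x_k}{\partial x_j}=\delta_{jk}$ and $\frac{\partial (ab)}{\partial x_j}=\frac{\partial a}{\partial x_j}b+(-1)^i a\frac{\partial b}{\partial x_j}$ for $a\in\Lambda_{n,i}$. For $\sigma\in\Gamma\,\mathrm{GL}_n(K)^{op}$ the entries $\partial\sigma(x_\nu)/\partial x_\mu$ are even, hence central, and $\det(\partial\sigma(x_\nu)/\partial x_\mu)$ is a unit of $\Lambda_n$. The determinant with a row of operators is expanded along that row, $\sum_k C_{ik}\frac{\partial}{\partial x_k}$, with $C_{ik}$ the cofactors acting by left multiplication; an element of $\Lambda_n$ in front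 of an operator acts by left multiplication. *)

theory Defs
  imports "HOL-Analysis.Determinants" "HOL-Library.Poly_Mapping"
begin

section \<open>The Grassmann algebra\<close>

text \<open>
  Words in the letters \<open>'n\<close> under concatenation, written additively because \<open>Poly_Mapping\<close> builds
  monoid algebras over additive monoids. Thus \<open>'n free_monoid \<Rightarrow>\<^sub>0 'k\<close> is the free associative
  \<open>'k\<close>-algebra on \<open>'n\<close>.
\<close>

datatype 'n free_monoid = Word (letters: "'n list")

instantiation free_monoid :: (type) monoid_add
begin
definition zero_free_monoid :: "'a free_monoid" where "0 = Word []"
definition plus_free_monoid :: "'a free_monoid \<Rightarrow> 'a free_monoid \<Rightarrow> 'a free_monoid"
  where "u + v = Word (letters u @ letters v)"
instance
  by standard (simp_all add: zero_free_monoid_def plus_free_monoid_def)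
end

lemma free_monoid_add_eq_0_iff: "0 = u + v \<longleftrightarrow> u = 0 \<and> v = (0 :: 'n free_monoid)"
  by (cases u; cases v) (auto simp: zero_free_monoid_def plus_free_monoid_def)

abbreviation free_var :: "'n \<Rightarrow> ('n free_monoid \<Rightarrow>\<^sub>0 'k::comm_ring_1)"
  where "free_var i \<equiv> Poly_Mapping.single (Word [i]) 1"

text \<open>The two-sided ideal generated by the defining relations.\<close>

inductive_set grassmann_ideal :: "('n free_monoid \<Rightarrow>\<^sub>0 'k::comm_ring_1) set" where
  square: "free_var i * free_var i \<in> grassmann_ideal"
| anticomm: "i \<noteq> j \<Longrightarrow> free_var i * free_var j + free_var j * free_var i \<in> grassmann_ideal"
| zero: "0 \<in> grassmann_ideal"
| add: "p \<in> grassmann_ideal \<Longrightarrow> q \<in> grassmann_ideal \<Longrightarrow> p + q \<in> grassmann_ideal"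
| mult_left: "p \<in> grassmann_ideal \<Longrightarrow> r * p \<in> grassmann_ideal"
| mult_right: "p \<in> grassmann_ideal \<Longrightarrow> p * r \<in> grassmann_ideal"

lemma grassmann_ideal_uminus: "p \<in> grassmann_ideal \<Longrightarrow> - p \<in> grassmann_ideal"
  using grassmann_ideal.mult_left[of p "- 1"] by simp

lemma grassmann_ideal_diff: "p \<in> grassmann_ideal \<Longrightarrow> q \<in> grassmann_ideal \<Longrightarrow> p - q \<in> grassmann_ideal"
  using grassmann_ideal.add[of p "- q"] grassmann_ideal_uminus[of q] by simp

lemma lookup_mult_0:
  fixes p q :: "'n free_monoid \<Rightarrow>\<^sub>0 'k::comm_ring_1"
  shows "Poly_Mapping.lookup (p * q) 0 = Poly_Mapping.lookup p 0 * Poly_Mapping.lookup q 0"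
proof -
  have "Poly_Mapping.lookup (p * q) 0
      = (\<Sum>l. Poly_Mapping.lookup p l * (\<Sum>m. (Poly_Mapping.lookup q m when (0 = l + m))))"
    by (simp add: times_poly_mapping.rep_eq prod_fun_def)
  also have "\<dots> = (\<Sum>l. (Poly_Mapping.lookup p l * Poly_Mapping.lookup q 0 when l = 0))"
    by (intro Sum_any.cong) (auto simp: free_monoid_add_eq_0_iff when_def)
  finally show ?thesis by simp
qed

lemma lookup_free_var_0: "Poly_Mapping.lookup (free_var i) 0 = 0"
  by (simp add: lookup_single zero_free_monoid_def)

lemma grassmann_ideal_lookup_0: "p \<in> grassmann_ideal \<Longrightarrow> Poly_Mapping.lookup p 0 = 0"
  by (induction rule: grassmann_ideal.induct)
    (simp_all add: lookup_mult_0 lookup_add lookup_free_var_0)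

quotient_type (overloaded) ('n, 'k) grassmann = "'n free_monoid \<Rightarrow>\<^sub>0 'k::comm_ring_1"
  / "\<lambda>p q. p - q \<in> grassmann_ideal"
  morphisms rep_grassmann abs_grassmann
proof (rule equivpI)
  show "reflp (\<lambda>p q :: 'n free_monoid \<Rightarrow>\<^sub>0 'k. p - q \<in> grassmann_ideal)"
    by (simp add: reflp_def grassmann_ideal.zero)
  show "symp (\<lambda>p q :: 'n free_monoid \<Rightarrow>\<^sub>0 'k. p - q \<in> grassmann_ideal)"
    unfolding symp_def using grassmann_ideal_uminus by fastforce
  show "transp (\<lambda>p q :: 'n free_monoid \<Rightarrow>\<^sub>0 'k. p - q \<in> grassmann_ideal)"
    unfolding transp_def using grassmann_ideal.add by fastforce
qed

instantiation grassmann :: (type, comm_ring_1) ring_1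
begin
lift_definition zero_grassmann :: "('a, 'b) grassmann" is 0 .
lift_definition one_grassmann :: "('a, 'b) grassmann" is 1 .
lift_definition plus_grassmann :: "('a, 'b) grassmann \<Rightarrow> ('a, 'b) grassmann \<Rightarrow> ('a, 'b) grassmann"
  is "(+)"
  by (simp only: add_diff_add grassmann_ideal.add)
lift_definition minus_grassmann :: "('a, 'b) grassmann \<Rightarrow> ('a, 'b) grassmann \<Rightarrow> ('a, 'b) grassmann"
  is "(-)"
proof -
  fix p p' q q' :: "'a free_monoid \<Rightarrow>\<^sub>0 'b"
  assume "p - p' \<in> grassmann_ideal" "q - q' \<in> grassmann_ideal"
  then have "(p - p') - (q - q') \<in> grassmann_ideal"
    by (rule grassmann_ideal_diff)
  then show "p - q - (p' - q') \<in> grassmann_ideal"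
    by (simp add: algebra_simps)
qed
lift_definition uminus_grassmann :: "('a, 'b) grassmann \<Rightarrow> ('a, 'b) grassmann" is uminus
  by (simp only: minus_diff_minus grassmann_ideal_uminus)
lift_definition times_grassmann :: "('a, 'b) grassmann \<Rightarrow> ('a, 'b) grassmann \<Rightarrow> ('a, 'b) grassmann"
  is "(*)"
proof -
  fix p p' q q' :: "'a free_monoid \<Rightarrow>\<^sub>0 'b"
  assume "p - p' \<in> grassmann_ideal" "q - q' \<in> grassmann_ideal"
  then have "(p - p') * q + p' * (q - q') \<in> grassmann_ideal"
    by (intro grassmann_ideal.intros)
  then show "p * q - p' * q' \<in> grassmann_ideal"
    by (simp add: algebra_simps)
qed
instance
proof
  show "(0 :: ('a, 'b) grassmann) \<noteq> 1"
  proof transfer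
    show "(0 :: 'a free_monoid \<Rightarrow>\<^sub>0 'b) - 1 \<notin> grassmann_ideal"
      using grassmann_ideal_lookup_0[of "0 - 1 :: 'a free_monoid \<Rightarrow>\<^sub>0 'b"]
      by (auto simp: lookup_minus)
  qed
qed (transfer; simp add: algebra_simps grassmann_ideal.zero)+
end

lift_definition gen :: "'n \<Rightarrow> ('n, 'k::comm_ring_1) grassmann" is free_var .

lift_definition gscale :: "'k::comm_ring_1 \<Rightarrow> ('n, 'k) grassmann \<Rightarrow> ('n, 'k) grassmann"
  is "\<lambda>c p. Poly_Mapping.single 0 c * p"
  by (simp add: grassmann_ideal.mult_left flip: right_diff_distrib)

lemma gen_square: "gen i * gen i = 0"
  by transfer (simp add: grassmann_ideal.square)

lemma gen_anticomm: "i \<noteq> j \<Longrightarrow> gen i * gen j = - (gen j * gen i)"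
  by transfer (simp add: grassmann_ideal.anticomm)

global_interpretation grassmann: module "gscale :: 'k::comm_ring_1 \<Rightarrow> ('n, 'k) grassmann \<Rightarrow> ('n, 'k) grassmann"
  defines gspan = grassmann.span
proof
  fix a b :: 'k and u v :: "('n, 'k) grassmann"
  show "gscale a (u + v) = gscale a u + gscale a v"
    by transfer (simp add: distrib_left grassmann_ideal.zero)
  show "gscale (a + b) u = gscale a u + gscale b u"
    by transfer (simp add: single_add distrib_right grassmann_ideal.zero)
  show "gscale a (gscale b u) = gscale (a * b) u"
    by transfer (simp add: mult_single grassmann_ideal.zero flip: mult.assoc)
  show "gscale 1 u = u"
    by transfer (simp add: grassmann_ideal.zero)
qed

lemma gscale_mult_left: "gscale c a * b = gscale c (a * b)"
  by transfer (simp add: mult.assoc grassmann_ideal.zero)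


section \<open>Grading\<close>

definition grade :: "nat \<Rightarrow> ('n, 'k::comm_ring_1) grassmann set" where
  "grade d = gspan {prod_list (map gen is) | is. length is = d}"

definition odd_part :: "('n, 'k::comm_ring_1) grassmann set" where
  "odd_part = gspan (\<Union>d\<in>{d. odd d}. grade d)"

definition aug_ideal :: "('n, 'k::comm_ring_1) grassmann set" where
  "aug_ideal = gspan (\<Union>d\<in>{1..}. grade d)"

primrec aug_ideal_power :: "nat \<Rightarrow> ('n, 'k::comm_ring_1) grassmann set" where
  "aug_ideal_power 0 = UNIV"
| "aug_ideal_power (Suc r) = gspan {a * b | a b. a \<in> aug_ideal \<and> b \<in> aug_ideal_power r}"


section \<open>Automorphisms\<close>

definition alg_automorphism ::
  "(('n, 'k::comm_ring_1) grassmann \<Rightarrow> ('n, 'k) grassmann) \<Rightarrow> bool" where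
  "alg_automorphism \<sigma> \<longleftrightarrow> module_hom gscale gscale \<sigma> \<and> \<sigma> 1 = 1 \<and> (\<forall>a b. \<sigma> (a * b) = \<sigma> a * \<sigma> b) \<and> bij \<sigma>"

definition Gamma :: "(('n, 'k::comm_ring_1) grassmann \<Rightarrow> ('n, 'k) grassmann) set" where
  "Gamma = {\<sigma>. alg_automorphism \<sigma> \<and> (\<forall>i. \<sigma> (gen i) - gen i \<in> odd_part \<inter> aug_ideal_power 3)}"

definition GL_op :: "(('n::finite, 'k::comm_ring_1) grassmann \<Rightarrow> ('n, 'k) grassmann) set" where
  "GL_op = {\<tau>. alg_automorphism \<tau> \<and>
    (\<exists>A :: 'k^'n^'n. invertible A \<and> (\<forall>i. \<tau> (gen i) = (\<Sum>j\<in>UNIV. gscale (A $ i $ j) (gen j))))}"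

definition Gamma_GL_op :: "(('n::finite, 'k::comm_ring_1) grassmann \<Rightarrow> ('n, 'k) grassmann) set" where
  "Gamma_GL_op = {\<gamma> \<circ> \<tau> | \<gamma> \<tau>. \<gamma> \<in> Gamma \<and> \<tau> \<in> GL_op}"


section \<open>Left skew derivations and the Jacobian matrix\<close>

definition skew_deriv :: "'n \<Rightarrow> ('n, 'k::comm_ring_1) grassmann \<Rightarrow> ('n, 'k) grassmann" where
  "skew_deriv j = (THE D. module_hom gscale gscale D
     \<and> (\<forall>k. D (gen k) = (if j = k then 1 else 0))
     \<and> (\<forall>i. \<forall>a\<in>grade i. \<forall>b. D (a * b) = D a * b + (- 1) ^ i * a * D b))"

text \<open>
  The Leibniz formula over a possibly non-commutative ring, the factors taken in the order of their
  rows: \<^const>\<open>det\<close> asks for a commutative ring of entries. It is only applied to matrices with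
  pairwise commuting entries, where the order is immaterial.
\<close>

definition ndet :: "'a::ring_1 ^ 'n::{finite,linorder} ^ 'n::{finite,linorder} \<Rightarrow> 'a" where
  "ndet M = (\<Sum>p | p permutes (UNIV :: 'n set).
     of_int (sign p) * prod_list (map (\<lambda>i. M $ i $ p i) (sorted_list_of_set UNIV)))"

text \<open>
  The cofactor at position \<open>(i, k)\<close>: replacing row \<open>i\<close> by the \<open>k\<close>-th unit row leaves the signed minor.
\<close>

definition ncofactor :: "'a::ring_1 ^ 'n::{finite,linorder} ^ 'n::{finite,linorder} \<Rightarrow> 'n \<Rightarrow> 'n \<Rightarrow> 'a" where
  "ncofactor M i k = ndet (\<chi> r. if r = i then axis k 1 else M $ r)"

definition ring_inverse :: "'a::ring_1 \<Rightarrow> 'a" where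
  "ring_inverse u = (THE v. u * v = 1 \<and> v * u = 1)"

definition jacobian ::
  "(('n::finite, 'k::comm_ring_1) grassmann \<Rightarrow> ('n, 'k) grassmann) \<Rightarrow> ('n, 'k) grassmann ^ 'n ^ 'n" where
  "jacobian \<sigma> = (\<chi> \<nu> \<mu>. skew_deriv \<mu> (\<sigma> (gen \<nu>)))"

text \<open>
  The operators \<open>\<partial>'\<^sub>i\<close>. Row \<open>i\<close> of \<^term>\<open>jacobian \<sigma>\<close> does not enter its cofactors along row \<open>i\<close>, so these
  are the cofactors of the matrix whose row \<open>i\<close> consists of the operators.
\<close>

definition deriv' ::
  "(('n::{finite,linorder}, 'k::comm_ring_1) grassmann \<Rightarrow> ('n, 'k) grassmann) \<Rightarrow> 'n
    \<Rightarrow> ('n, 'k) grassmann \<Rightarrow> ('n, 'k) grassmann" where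
  "deriv' \<sigma> i a = ring_inverse (ndet (jacobian \<sigma>))
     * (\<Sum>k\<in>UNIV. ncofactor (jacobian \<sigma>) i k * skew_deriv k a)"

text \<open>
  In the next two definitions \<^const>\<open>fold\<close> applies the operator with the smallest index first, so that
  it stands rightmost in the composition.
\<close>

definition deriv'_pow ::
  "(('n::{finite,linorder}, 'k::comm_ring_1) grassmann \<Rightarrow> ('n, 'k) grassmann) \<Rightarrow> 'n set
    \<Rightarrow> ('n, 'k) grassmann \<Rightarrow> ('n, 'k) grassmann" where
  "deriv'_pow \<sigma> \<alpha> = fold (deriv' \<sigma>) (sorted_list_of_set \<alpha>)"

definition phi ::
  "(('n::{finite,linorder}, 'k::comm_ring_1) grassmann \<Rightarrow> ('n, 'k) grassmann)
    \<Rightarrow> ('n, 'k) grassmann \<Rightarrow> ('n, 'k) grassmann" where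
  "phi \<sigma> = fold (\<lambda>i a. a - \<sigma> (gen i) * deriv' \<sigma> i a) (sorted_list_of_set UNIV)"

definition gen_pow :: "'n::{finite,linorder} set \<Rightarrow> ('n, 'k::comm_ring_1) grassmann" where
  "gen_pow \<alpha> = prod_list (map gen (sorted_list_of_set \<alpha>))"

end

theory Submission
  imports Defs
begin

text \<open>
  Parity makes the images \<open>\<sigma>(x\<^sub>i)\<close> odd and the Jacobian entries even, hence central. The chain rule
  \<open>\<partial>\<^sub>k(\<sigma>(b)) = \<Sum>\<^sub>j \<partial>\<^sub>k(\<sigma>(x\<^sub>j)) \<sigma>(\<partial>\<^sub>j(b))\<close>, applied to \<open>b = \<sigma>\<^sup>-\<^sup>1(x\<^sub>l)\<close> and projected to even parts, shows
  that the Jacobian matrix is invertible with central inverse; solving it by Cramer's rule gives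
  \<open>\<partial>'\<^sub>i \<circ> \<sigma> = \<sigma> \<circ> \<partial>\<^sub>i\<close>. So the formula is the image under \<open>\<sigma>\<close> of the fact that
  \<open>(1 - x\<^sub>n\<partial>\<^sub>n)\<cdots>(1 - x\<^sub>1\<partial>\<^sub>1)\<partial>\<^sup>\<alpha>\<close> extracts the coefficient of \<open>x\<^sup>\<alpha>\<close>, and coefficients are fixed by \<open>\<sigma>\<close>.
\<close>

section \<open>Linear maps out of the free algebra\<close>

lemma poly_mapping_induct_single_add [case_names single add]:
  fixes p :: "'a \<Rightarrow>\<^sub>0 'b::monoid_add"
  assumes single: "\<And>u c. P (Poly_Mapping.single u c)"
    and add: "\<And>p q. P p \<Longrightarrow> P q \<Longrightarrow> P (p + q)"
  shows "P p"
proof (induction p rule: update_induct)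
  case const
  show ?case using single[of undefined 0] by simp
next
  case (update f a b)
  have "Poly_Mapping.update a b f = Poly_Mapping.single a b + f"
    using update(1)
    by (intro poly_mapping_eqI) (auto simp: lookup_update lookup_add lookup_single when_def in_keys_iff)
  then show ?case using add[OF single update.IH] by simp
qed

abbreviation gword :: "'n list \<Rightarrow> ('n, 'k::comm_ring_1) grassmann"
  where "gword w \<equiv> prod_list (map gen w)"

text \<open>Words form a basis of the free algebra, so a map out of the Grassmann algebra can be
  prescribed on words, extended linearly, and lifted to the quotient once it kills
  \<open>grassmann_ideal\<close>. The even projection and the derivations are both built this
  way.\<close>

definition lin_ext ::
  "('n list \<Rightarrow> ('n, 'k::comm_ring_1) grassmann) \<Rightarrow> ('n free_monoid \<Rightarrow>\<^sub>0 'k) \<Rightarrow> ('n, 'k) grassmann"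
  where "lin_ext f p = (\<Sum>u\<in>Poly_Mapping.keys p. gscale (Poly_Mapping.lookup p u) (f (letters u)))"

lemma lin_ext_single: "lin_ext f (Poly_Mapping.single u c) = gscale c (f (letters u))"
  by (simp add: lin_ext_def)

lemma lin_ext_add: "lin_ext f (p + q) = lin_ext f p + lin_ext f q"
  unfolding lin_ext_def
  by (rule setsum_keys_plus_distrib) (simp_all add: grassmann.scale_left_distrib)

lemma lin_ext_0: "lin_ext f 0 = 0"
  by (simp add: lin_ext_def)

lemma lin_ext_diff: "lin_ext f (p - q) = lin_ext f p - lin_ext f q"
  by (metis add_diff_cancel_right' diff_add_cancel lin_ext_add)

lemma single_0_mult_commute:
  "Poly_Mapping.single 0 c * p = p * Poly_Mapping.single (0 :: 'a::monoid_add) (c :: 'k::comm_ring_1)"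
  by (induction p rule: poly_mapping_induct_single_add) (simp_all add: mult_single ring_distribs mult.commute)

lemma gscale_mult_right: "a * gscale c b = gscale c (a * b)"
proof transfer
  fix a b :: "'a free_monoid \<Rightarrow>\<^sub>0 'b" and c
  have "a * (Poly_Mapping.single 0 c * b) = Poly_Mapping.single 0 c * (a * b)"
    by (metis single_0_mult_commute mult.assoc)
  then show "a * (Poly_Mapping.single 0 c * b) - Poly_Mapping.single 0 c * (a * b) \<in> grassmann_ideal"
    by (simp add: grassmann_ideal.zero)
qed

lemma abs_grassmann_single_Word: "abs_grassmann (Poly_Mapping.single (Word w) c) = gscale c (gword w)"
proof (induction w arbitrary: c)
  case Nil
  show ?case
    by (simp add: one_grassmann_def gscale.abs_eq flip: zero_free_monoid_def)
next
  case (Cons i w)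
  have "Poly_Mapping.single (Word (i # w)) c = free_var i * Poly_Mapping.single (Word w) c"
    by (simp add: mult_single plus_free_monoid_def)
  then have "abs_grassmann (Poly_Mapping.single (Word (i # w)) c)
      = gen i * abs_grassmann (Poly_Mapping.single (Word w) c)"
    by (simp add: gen_def times_grassmann.abs_eq)
  then show ?case by (simp add: Cons.IH gscale_mult_right)
qed

lemma abs_grassmann_eq_lin_ext: "abs_grassmann p = lin_ext gword p"
proof (induction p rule: poly_mapping_induct_single_add)
  case (single u c)
  show ?case by (cases u) (simp add: abs_grassmann_single_Word lin_ext_single)
qed (simp add: lin_ext_add flip: plus_grassmann.abs_eq)

text \<open>Monomials arise from 1 by repeatedly putting a generator on the left, so the
  multiplicative step only has to treat an odd left factor \<open>gen i\<close>.\<close>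

lemma grassmann_induct [case_names one gen add scale]:
  assumes "P 1" "\<And>i a. P a \<Longrightarrow> P (gen i * a)" "\<And>a b. P a \<Longrightarrow> P b \<Longrightarrow> P (a + b)"
    "\<And>c a. P a \<Longrightarrow> P (gscale c a)"
  shows "P a"
proof -
  have word: "P (gword w)" for w
    by (induction w) (simp_all add: assms)
  have "P (abs_grassmann p)" for p
  proof (induction p rule: poly_mapping_induct_single_add)
    case (single u c)
    show ?case by (cases u) (simp add: abs_grassmann_single_Word word assms)
  qed (simp add: assms flip: plus_grassmann.abs_eq)
  then show ?thesis by (rule grassmann.abs_induct)
qed

text \<open>Both sides are bilinear, so words suffice. The two-term shape serves twice: for the
  parity of a concatenation and for the skew Leibniz rule.\<close>

lemma lin_ext_mult_cong:
  assumes "\<And>u v. f (u @ v) = g1 u * h1 v + g2 u * h2 v"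
  shows "lin_ext f (p * q) = lin_ext g1 p * lin_ext h1 q + lin_ext g2 p * lin_ext h2 q"
proof (induction p rule: poly_mapping_induct_single_add)
  case (single u c)
  show ?case
  proof (induction q rule: poly_mapping_induct_single_add)
    case (single v d)
    show ?case
      by (simp add: mult_single lin_ext_single plus_free_monoid_def assms gscale_mult_left
          gscale_mult_right grassmann.scale_right_distrib mult.commute[of c])
  qed (simp add: ring_distribs lin_ext_add)
qed (simp add: ring_distribs lin_ext_add)

section \<open>Parity\<close>

definition even_word :: "'n list \<Rightarrow> ('n, 'k::comm_ring_1) grassmann"
  where "even_word w = (if even (length w) then gword w else 0)"

definition odd_word :: "'n list \<Rightarrow> ('n, 'k::comm_ring_1) grassmann"
  where "odd_word w = (if even (length w) then 0 else gword w)"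

lemma lin_ext_odd_word: "lin_ext odd_word p = abs_grassmann p - lin_ext even_word p"
proof -
  have "lin_ext odd_word p + lin_ext even_word p = lin_ext gword p"
    unfolding lin_ext_def by (auto simp: odd_word_def even_word_def simp flip: sum.distrib intro!: sum.cong)
  then show ?thesis by (simp add: abs_grassmann_eq_lin_ext algebra_simps)
qed

lemma lin_ext_even_word_mult:
  "lin_ext even_word (p * q)
    = lin_ext even_word p * lin_ext even_word q + lin_ext odd_word p * lin_ext odd_word q"
  by (rule lin_ext_mult_cong) (simp add: even_word_def odd_word_def)

lemma abs_grassmann_ideal: "p \<in> grassmann_ideal \<Longrightarrow> abs_grassmann p = 0"
  using grassmann.abs_eq_iff[of p 0] by (simp flip: zero_grassmann_def)

text \<open>The defining relations are homogeneous of degree 2, so their even part is the relation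
  itself, which vanishes in the quotient. The odd part of an ideal element is its class minus its
  even part and vanishes too, so both summands of \<open>lin_ext_even_word_mult\<close> do.\<close>

lemma lin_ext_even_word_ideal: "p \<in> grassmann_ideal \<Longrightarrow> lin_ext even_word p = 0"
proof (induction rule: grassmann_ideal.induct)
  case (square i)
  then show ?case
    by (simp add: mult_single plus_free_monoid_def lin_ext_single even_word_def gen_square)
next
  case (anticomm i j)
  then show ?case
    by (simp add: mult_single plus_free_monoid_def lin_ext_single lin_ext_add even_word_def gen_anticomm[of i j])
next
  case (mult_left p r)
  then show ?case
    by (simp add: lin_ext_even_word_mult lin_ext_odd_word abs_grassmann_ideal)
next
  case (mult_right p r)
  then show ?case
    by (simp add: lin_ext_even_word_mult lin_ext_odd_word abs_grassmann_ideal)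
qed (simp_all add: lin_ext_0 lin_ext_add)

lift_definition even_proj :: "('n, 'k::comm_ring_1) grassmann \<Rightarrow> ('n, 'k) grassmann"
  is "lin_ext even_word"
proof -
  fix p q :: "'n free_monoid \<Rightarrow>\<^sub>0 'k"
  assume "p - q \<in> grassmann_ideal"
  then show "lin_ext even_word p = lin_ext even_word q"
    using lin_ext_even_word_ideal[of "p - q"] by (simp add: lin_ext_diff)
qed

lemma even_proj_mult:
  "even_proj (a * b) = even_proj a * even_proj b + (a - even_proj a) * (b - even_proj b)"
proof (induction a rule: grassmann.abs_induct; induction b rule: grassmann.abs_induct)
  fix p q :: "'a free_monoid \<Rightarrow>\<^sub>0 'b"
  let ?a = "abs_grassmann p" and ?b = "abs_grassmann q"
  show "even_proj (?a * ?b) = even_proj ?a * even_proj ?b + (?a - even_proj ?a) * (?b - even_proj ?b)"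
    by (simp add: times_grassmann.abs_eq even_proj.abs_eq lin_ext_even_word_mult lin_ext_odd_word)
qed

lemma lin_ext_scale: "lin_ext f (Poly_Mapping.single 0 c * p) = gscale c (lin_ext f p)"
  by (induction p rule: poly_mapping_induct_single_add)
    (simp_all add: mult_single lin_ext_single lin_ext_add distrib_left grassmann.scale_right_distrib)

lemma module_hom_even_proj: "module_hom gscale gscale even_proj"
proof
  fix a b :: "('n, 'k::comm_ring_1) grassmann" and c
  show "even_proj (a + b) = even_proj a + even_proj b" for a b :: "('n, 'k) grassmann"
    by transfer (rule lin_ext_add)
  show "even_proj (gscale c a) = gscale c (even_proj a)"
    by transfer (rule lin_ext_scale)
qed

lemmas even_proj_simps [simp] =
  module_hom.add[OF module_hom_even_proj] module_hom.scale[OF module_hom_even_proj]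
  module_hom.diff[OF module_hom_even_proj] module_hom.zero[OF module_hom_even_proj]
  module_hom.neg[OF module_hom_even_proj] module_hom.sum[OF module_hom_even_proj]

lemma even_proj_gword:
  "even_proj (gword w) = (if even (length w) then gword w else (0 :: ('n, 'k::comm_ring_1) grassmann))"
proof -
  have "(gword w :: ('n, 'k) grassmann) = abs_grassmann (Poly_Mapping.single (Word w) 1)"
    by (simp add: abs_grassmann_single_Word)
  then show ?thesis by (simp add: even_proj.abs_eq lin_ext_single even_word_def)
qed

lemma even_proj_1 [simp]: "even_proj 1 = 1"
  using even_proj_gword[of "[]"] by simp

lemma even_proj_gen [simp]: "even_proj (gen i) = 0"
  using even_proj_gword[of "[i]"] by simp

lemma even_proj_gen_mult: "even_proj (gen i * a) = gen i * (a - even_proj a)"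
  by (simp add: even_proj_mult)

lemma even_proj_idem: "even_proj (even_proj a) = even_proj a"
  by (induction a rule: grassmann_induct) (simp_all add: even_proj_gen_mult right_diff_distrib)

text \<open>\<open>2 * even_proj a - a\<close> is the even part minus the odd part, i.e. the grade
  involution. In this form the sign rule covers inhomogeneous \<open>a\<close> and any coefficient
  ring, also one where 2 is not invertible.\<close>

lemma mult_gen_right: "a * gen i = gen i * (2 * even_proj a - a)"
proof (induction a rule: grassmann_induct)
  case (gen j a)
  \<comment> \<open>The case \<open>i = j\<close> obeys the same sign rule because both products are
    0.\<close>
  have anticomm: "gen j * gen i = - (gen i * gen j :: ('a, 'b) grassmann)"
    by (cases "i = j") (simp_all add: gen_square gen_anticomm[of j i])
  have "gen j * a * gen i = gen j * gen i * (2 * even_proj a - a)"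
    by (simp add: mult.assoc gen)
  also have "\<dots> = gen i * (gen j * (a - 2 * even_proj a))"
    by (simp add: anticomm mult.assoc algebra_simps)
  also have "gen j * (a - 2 * even_proj a) = 2 * even_proj (gen j * a) - gen j * a"
    by (simp add: even_proj_gen_mult algebra_simps mult_2 mult_2_right)
  finally show ?case .
next
  case (add a b)
  then show ?case by (simp add: algebra_simps)
next
  case (scale c a)
  then show ?case by (simp add: gscale_mult_left gscale_mult_right mult_2 flip: grassmann.scale_right_distrib grassmann.scale_right_diff_distrib)
qed simp

text \<open>The grade involution fixes an even element, which therefore commutes with every
  generator, and the generators generate the algebra.\<close>

lemma even_central:
  assumes "even_proj a = a"
  shows "a * b = b * a"
proof (induction b rule: grassmann_induct)
  case (gen i b)
  have "a * gen i = gen i * a"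
    using mult_gen_right[of a i] assms by (simp add: algebra_simps mult_2)
  then have "a * (gen i * b) = gen i * (a * b)"
    by (simp flip: mult.assoc)
  then show ?case by (simp add: gen mult.assoc)
qed (simp_all add: ring_distribs gscale_mult_left gscale_mult_right)

lemma grade_even_proj:
  assumes "a \<in> grade d"
  shows "even_proj a = (if even d then a else 0)"
  using assms unfolding grade_def
proof (induction rule: grassmann.span_induct_alt)
  case (step c x y)
  then show ?case by (auto simp: even_proj_gword split: if_splits)
qed simp

lemma odd_part_even_proj: "a \<in> odd_part \<Longrightarrow> even_proj a = 0"
  unfolding odd_part_def
  by (induction rule: grassmann.span_induct_alt) (auto simp: grade_even_proj)

section \<open>Skew derivations\<close>

text \<open>The recursion is the skew Leibniz rule at the first letter, whose odd degree gives the
  minus sign.\<close>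

primrec deriv_word :: "'n \<Rightarrow> 'n list \<Rightarrow> ('n, 'k::comm_ring_1) grassmann" where
  "deriv_word j [] = 0"
| "deriv_word j (i # w) = (if j = i then gword w else 0) - gen i * deriv_word j w"

text \<open>The grade involution on words. It carries the sign of the skew Leibniz rule, so that the
  rule can be stated for all elements instead of degree by degree.\<close>

definition twisted_word :: "'n list \<Rightarrow> ('n, 'k::comm_ring_1) grassmann"
  where "twisted_word w = (if even (length w) then gword w else - gword w)"

lemma deriv_word_append:
  "deriv_word j (u @ v) = deriv_word j u * gword v + twisted_word u * deriv_word j v"
  by (induction u) (simp_all add: twisted_word_def algebra_simps)

lemma lin_ext_twisted_word: "lin_ext twisted_word p = 2 * lin_ext even_word p - abs_grassmann p"
proof (induction p rule: poly_mapping_induct_single_add)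
  case (single u c)
  show ?case
    by (simp add: abs_grassmann_eq_lin_ext lin_ext_single twisted_word_def even_word_def mult_2)
next
  case (add p q)
  then show ?case
    by (simp only: lin_ext_add abs_grassmann_eq_lin_ext distrib_left add_diff_add)
qed

lemma lin_ext_deriv_word_mult:
  "lin_ext (deriv_word j) (p * q)
    = lin_ext (deriv_word j) p * abs_grassmann q
      + (2 * lin_ext even_word p - abs_grassmann p) * lin_ext (deriv_word j) q"
  using lin_ext_mult_cong[of "deriv_word j", OF deriv_word_append]
  by (simp add: lin_ext_twisted_word abs_grassmann_eq_lin_ext)

text \<open>On the defining relations the two Leibniz terms cancel. For a multiple of an ideal
  element \<open>p\<close>, each Leibniz term contains the derivative of \<open>p\<close>, its
  class, or its twisted class; the last vanishes because the even part of \<open>p\<close>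
  does.\<close>

lemma lin_ext_deriv_word_ideal: "p \<in> grassmann_ideal \<Longrightarrow> lin_ext (deriv_word j) p = 0"
proof (induction rule: grassmann_ideal.induct)
  case (mult_left p r)
  then show ?case by (simp add: lin_ext_deriv_word_mult abs_grassmann_ideal)
next
  case (mult_right p r)
  then show ?case by (simp add: lin_ext_deriv_word_mult abs_grassmann_ideal lin_ext_even_word_ideal)
qed (simp_all add: lin_ext_0 lin_ext_add mult_single plus_free_monoid_def lin_ext_single)

lift_definition pderiv :: "'n \<Rightarrow> ('n, 'k::comm_ring_1) grassmann \<Rightarrow> ('n, 'k) grassmann"
  is "\<lambda>j. lin_ext (deriv_word j)"
proof -
  fix j and p q :: "'n free_monoid \<Rightarrow>\<^sub>0 'k"
  assume "p - q \<in> grassmann_ideal"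
  then show "lin_ext (deriv_word j) p = lin_ext (deriv_word j) q"
    using lin_ext_deriv_word_ideal[of "p - q" j] by (simp add: lin_ext_diff)
qed

lemma pderiv_mult: "pderiv j (a * b) = pderiv j a * b + (2 * even_proj a - a) * pderiv j b"
proof (induction a rule: grassmann.abs_induct; induction b rule: grassmann.abs_induct)
  fix p q :: "'a free_monoid \<Rightarrow>\<^sub>0 'b"
  let ?a = "abs_grassmann p" and ?b = "abs_grassmann q"
  show "pderiv j (?a * ?b) = pderiv j ?a * ?b + (2 * even_proj ?a - ?a) * pderiv j ?b"
    by (simp add: times_grassmann.abs_eq even_proj.abs_eq pderiv.abs_eq lin_ext_deriv_word_mult)
qed

lemma module_hom_pderiv:
  "module_hom gscale gscale (pderiv j :: ('n, 'k::comm_ring_1) grassmann \<Rightarrow> _)"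
proof
  fix a b :: "('n, 'k) grassmann" and c
  show "pderiv j (a + b) = pderiv j a + pderiv j b"
    by transfer (rule lin_ext_add)
  show "pderiv j (gscale c a) = gscale c (pderiv j a)"
    by transfer (rule lin_ext_scale)
qed

lemmas pderiv_simps [simp] =
  module_hom.add[OF module_hom_pderiv] module_hom.scale[OF module_hom_pderiv]
  module_hom.diff[OF module_hom_pderiv] module_hom.zero[OF module_hom_pderiv]
  module_hom.neg[OF module_hom_pderiv]

lemma pderiv_gword: "pderiv j (gword w) = (deriv_word j w :: ('n, 'k::comm_ring_1) grassmann)"
proof -
  have "(gword w :: ('n, 'k) grassmann) = abs_grassmann (Poly_Mapping.single (Word w) 1)"
    by (simp add: abs_grassmann_single_Word)
  then show ?thesis by (simp add: pderiv.abs_eq lin_ext_single)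
qed

lemma pderiv_1 [simp]: "pderiv j 1 = 0"
  using pderiv_gword[of j "[]"] by simp

lemma pderiv_gen: "pderiv j (gen i) = (if j = i then 1 else 0)"
  using pderiv_gword[of j "[i]"] by (simp split: if_splits)

lemma pderiv_odd_mult: "even_proj a = 0 \<Longrightarrow> pderiv j (a * b) = pderiv j a * b - a * pderiv j b"
  by (simp add: pderiv_mult)

lemma pderiv_gen_mult: "pderiv j (gen i * a) = (if j = i then a else 0) - gen i * pderiv j a"
  by (simp add: pderiv_odd_mult pderiv_gen)

section \<open>Identification with the skew derivation characterised by its axioms\<close>

lemma gword_in_grade: "gword w \<in> grade (length w)"
  unfolding grade_def by (intro grassmann.span_base) blast

lemma gen_in_grade: "gen i \<in> grade 1"
  using gword_in_grade[of "[i]"] by simp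

lemma one_in_grade: "1 \<in> grade 0"
  using gword_in_grade[of "[]"] by simp

text \<open>Existence: on \<open>grade d\<close> the grade involution is the sign (-1)^d.
  Uniqueness: linearity and the Leibniz rule for a left factor \<open>gen i\<close> determine the
  map.\<close>

lemma skew_deriv_eq_pderiv: "skew_deriv j = pderiv j"
  unfolding skew_deriv_def
proof (rule the_equality, intro conjI allI ballI)
  show "module_hom gscale gscale (pderiv j)"
    by (rule module_hom_pderiv)
  show "pderiv j (gen k) = (if j = k then 1 else 0)" for k
    by (rule pderiv_gen)
  show "pderiv j (a * b) = pderiv j a * b + (- 1) ^ d * a * pderiv j b" if "a \<in> grade d" for d a b
    using that by (simp add: pderiv_mult grade_even_proj mult_2)
next
  fix D :: "('a, 'b) grassmann \<Rightarrow> ('a, 'b) grassmann"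
  assume D: "module_hom gscale gscale D \<and> (\<forall>k. D (gen k) = (if j = k then 1 else 0))
    \<and> (\<forall>i. \<forall>a\<in>grade i. \<forall>b. D (a * b) = D a * b + (- 1) ^ i * a * D b)"
  then interpret D: module_hom gscale gscale D by blast
  have Leibniz: "D (a * b) = D a * b + (- 1) ^ i * a * D b" if "a \<in> grade i" for a b i
    using D that by blast
  show "D = pderiv j"
  proof
    fix a
    show "D a = pderiv j a"
    proof (induction a rule: grassmann_induct)
      case one
      \<comment> \<open>Applied to \<open>1 * 1\<close> in degree 0, the rule reads
        \<open>D 1 = D 1 + D 1\<close>.\<close>
      show ?case using Leibniz[OF one_in_grade, of 1] by simp
    next
      case (gen i a)
      then show ?case using D by (simp add: Leibniz[OF gen_in_grade] pderiv_gen_mult)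
    qed (simp_all add: D.add D.scale)
  qed
qed

text \<open>A derivation lowers the degree by one and so exchanges parities; this is what makes the
  Jacobian entries even.\<close>

lemma even_proj_pderiv: "even_proj (pderiv j a) = pderiv j (a - even_proj a)"
proof (induction a rule: grassmann_induct)
  case (gen i a)
  then show ?case
    by (simp add: pderiv_gen_mult even_proj_gen_mult right_diff_distrib)
next
  case (add a b)
  then show ?case by (simp add: algebra_simps)
qed (simp_all flip: grassmann.scale_right_diff_distrib)

section \<open>Cramer's rule for matrices with central entries\<close>

text \<open>The centre is a commutative ring, so \<open>det\<close> and its theory apply to matrices
  over it; the embedding \<open>of_center\<close> then carries the results to \<open>ndet\<close>
  and \<open>ncofactor\<close>.\<close>

typedef (overloaded) 'a center = "{z :: 'a::ring_1. \<forall>b. z * b = b * z}"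
  morphisms of_center to_center
  by (rule exI[of _ 0]) simp

setup_lifting type_definition_center

instantiation center :: (ring_1) comm_ring_1
begin
lift_definition zero_center :: "'a center" is 0 by simp
lift_definition one_center :: "'a center" is 1 by simp
lift_definition plus_center :: "'a center \<Rightarrow> 'a center \<Rightarrow> 'a center" is "(+)"
  by (simp add: ring_distribs)
lift_definition minus_center :: "'a center \<Rightarrow> 'a center \<Rightarrow> 'a center" is "(-)"
  by (simp add: ring_distribs)
lift_definition uminus_center :: "'a center \<Rightarrow> 'a center" is uminus
  by simp
lift_definition times_center :: "'a center \<Rightarrow> 'a center \<Rightarrow> 'a center" is "(*)"
proof -
  fix y z b :: 'a
  assume y: "\<And>b. y * b = b * y" and z: "\<And>b. z * b = b * z"
  have "y * z * b = y * b * z"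
    by (simp only: mult.assoc z[of b])
  then show "y * z * b = b * (y * z)"
    by (simp only: y[of b] mult.assoc)
qed
instance
proof
  show "a * b = b * a" for a b :: "'a center"
    by transfer blast
  show "a * b * c = a * (b * c)" for a b c :: "'a center"
    by transfer (rule mult.assoc)
  show "(a + b) * c = a * c + b * c" for a b c :: "'a center"
    by transfer (rule distrib_right)
  show "a + b + c = a + (b + c)" for a b c :: "'a center"
    by transfer (rule add.assoc)
  show "a + b = b + a" for a b :: "'a center"
    by transfer (rule add.commute)
  show "a - b = a + - b" for a b :: "'a center"
    by transfer (rule diff_conv_add_uminus)
qed (transfer; simp (no_asm))+
end

lemma of_center_sum: "of_center (sum f A) = (\<Sum>x\<in>A. of_center (f x))"
  by (induction A rule: infinite_finite_induct) (simp_all add: zero_center.rep_eq plus_center.rep_eq)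

lemma of_center_prod_list: "of_center (prod_list xs) = prod_list (map of_center xs)"
  by (induction xs) (simp_all add: one_center.rep_eq times_center.rep_eq)

lemma of_center_sign: "of_center (of_int (sign p)) = of_int (sign p)"
  by (simp add: sign_def one_center.rep_eq uminus_center.rep_eq)

lemma prod_UNIV_conv_list:
  "(\<Prod>i\<in>UNIV. f i) = prod_list (map f (sorted_list_of_set (UNIV :: 'n::{finite,linorder} set)))"
  by (metis distinct_sorted_list_of_set finite prod.distinct_set_conv_list set_sorted_list_of_set)

lemma ndet_of_center: "ndet (\<chi> i j. of_center (M $ i $ j)) = of_center (det M)"
  unfolding ndet_def det_def of_center_sum times_center.rep_eq of_center_sign prod_UNIV_conv_list
    of_center_prod_list
  by (simp add: o_def)

section \<open>Inverses and cofactor expansion\<close>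

lemma ring_inverse_eq:
  assumes "u * v = 1" "v * u = 1"
  shows "ring_inverse u = v"
  unfolding ring_inverse_def
proof (rule the_equality)
  fix w
  assume w: "u * w = 1 \<and> w * u = 1"
  have "w = v * u * w"
    by (simp add: assms)
  also have "\<dots> = v"
    by (simp add: mult.assoc w)
  finally show "w = v" .
qed (use assms in simp)

text \<open>Write the new row in the standard basis and use linearity of the determinant in that
  row.\<close>

lemma det_replace_row:
  fixes M :: "'a::comm_ring_1 ^ 'n ^ 'n"
  shows "det (\<chi> r. if r = i then v else M $ r)
    = (\<Sum>k\<in>UNIV. det (\<chi> r. if r = i then axis k 1 else M $ r) * v $ k)"
proof -
  have "det (\<chi> r. if r = i then v else M $ r)
      = det (\<chi> r. if r = i then (\<Sum>k\<in>UNIV. v $ k *s axis k 1) else M $ r)"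
    by (simp only: basis_expansion)
  also have "\<dots> = (\<Sum>k\<in>UNIV. det (\<chi> r. if r = i then v $ k *s axis k 1 else M $ r))"
    by (rule det_linear_row_sum) simp
  also have "\<dots> = (\<Sum>k\<in>UNIV. det (\<chi> r. if r = i then axis k 1 else M $ r) * v $ k)"
    by (rule sum.cong[OF refl]) (simp only: det_row_mul mult.commute)
  finally show ?thesis .
qed

text \<open>The sum is the determinant after row \<open>i\<close> has been replaced by row
  \<open>j\<close>: the matrix is unchanged if \<open>i = j\<close> and has two equal rows
  otherwise.\<close>

lemma sum_cofactor_row:
  fixes M :: "'a::comm_ring_1 ^ 'n ^ 'n"
  shows "(\<Sum>k\<in>UNIV. det (\<chi> r. if r = i then axis k 1 else M $ r) * M $ j $ k)
    = (if i = j then det M else 0)"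
proof -
  have "det (\<chi> r. if r = i then M $ j else M $ r) = (if i = j then det M else 0)"
  proof (cases "i = j")
    case True
    then have "(\<chi> r. if r = i then M $ j else M $ r) = M"
      by (simp add: vec_eq_iff)
    then show ?thesis using True by simp
  next
    case False
    then have "det (\<chi> r. if r = i then M $ j else M $ r) = 0"
      by (intro det_identical_rows[of i j]) (simp_all add: row_def)
    then show ?thesis using False by simp
  qed
  then show ?thesis unfolding det_replace_row[of i "M $ j" M] .
qed

text \<open>The system \<open>f\<close> = (transpose of \<open>M\<close>) applied to
  \<open>g\<close> is solved by the cofactors. The vectors \<open>f\<close> and \<open>g\<close> may
  be non-central, so all coefficients stay on their left; \<open>N\<close> certifies that the
  determinant is a unit.\<close>

lemma central_cramer:
  fixes M N :: "'a::ring_1 ^ 'n::{finite,linorder} ^ 'n::{finite,linorder}"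
  assumes M: "\<And>i j b. M $ i $ j * b = b * M $ i $ j"
    and N: "\<And>i j b. N $ i $ j * b = b * N $ i $ j"
    and inverse: "\<And>k l. (\<Sum>j\<in>UNIV. M $ j $ k * N $ j $ l) = (if k = l then 1 else 0)"
    and f: "\<And>k. f k = (\<Sum>j\<in>UNIV. M $ j $ k * g j)"
  shows "ring_inverse (ndet M) * (\<Sum>k\<in>UNIV. ncofactor M i k * f k) = g i"
proof -
  define M' where "M' = (\<chi> i j. to_center (M $ i $ j))"
  define N' where "N' = (\<chi> i j. to_center (N $ i $ j))"
  have M': "of_center (M' $ i $ j) = M $ i $ j" for i j
    unfolding M'_def vec_lambda_beta by (rule to_center_inverse) (blast intro: M)
  have N': "of_center (N' $ i $ j) = N $ i $ j" for i j
    unfolding N'_def vec_lambda_beta by (rule to_center_inverse) (blast intro: N)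
  have "(\<Sum>j\<in>UNIV. M' $ j $ k * N' $ j $ l) = (if k = l then 1 else 0)" for k l
    by (rule of_center_inject[THEN iffD1])
      (simp add: of_center_sum times_center.rep_eq M' N' inverse zero_center.rep_eq one_center.rep_eq)
  \<comment> \<open>The transpose appears because the assumed sums run over the row index of
    \<open>M\<close>.\<close>
  then have "transpose M' ** N' = mat 1"
    by (simp add: vec_eq_iff matrix_matrix_mult_def transpose_def mat_def)
  then have "det (transpose M' ** N') = 1"
    by simp
  then have dets: "det M' * det N' = 1"
    by (simp add: det_mul)
  define C where "C k = det (\<chi> r. if r = i then axis k 1 else M' $ r)" for k
  have "(\<chi> i j. of_center (M' $ i $ j)) = M"
    by (simp add: vec_eq_iff M')
  then have ndet: "ndet M = of_center (det M')"
    using ndet_of_center[of M'] by (simp only:)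
  have "(\<chi> s j. of_center ((\<chi> r. if r = i then axis k 1 else M' $ r) $ s $ j))
      = (\<chi> r. if r = i then axis k 1 else M $ r)" for k
    by (simp add: vec_eq_iff M' axis_def zero_center.rep_eq one_center.rep_eq)
  then have ncofactor: "ncofactor M i k = of_center (C k)" for k
    unfolding ncofactor_def C_def using ndet_of_center by (simp only: flip: ndet_of_center)
  have "of_center (det M') * of_center (det N') = 1"
    by (simp only: dets one_center.rep_eq flip: times_center.rep_eq)
  moreover have "of_center (det N') * of_center (det M') = 1"
    by (simp only: dets mult.commute[of "det N'"] one_center.rep_eq flip: times_center.rep_eq)
  ultimately have inv: "ring_inverse (ndet M) = of_center (det N')"
    unfolding ndet by (rule ring_inverse_eq)
  have "of_center (det N') * (\<Sum>k\<in>UNIV. of_center (C k) * f k)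
      = (\<Sum>k\<in>UNIV. \<Sum>j\<in>UNIV. of_center (det N' * (C k * M' $ j $ k)) * g j)"
    by (simp add: f sum_distrib_left times_center.rep_eq M' mult.assoc)
  also have "\<dots> = (\<Sum>j\<in>UNIV. \<Sum>k\<in>UNIV. of_center (det N' * (C k * M' $ j $ k)) * g j)"
    by (rule sum.swap)
  also have "\<dots> = (\<Sum>j\<in>UNIV. of_center (det N' * (\<Sum>k\<in>UNIV. C k * M' $ j $ k)) * g j)"
    by (simp add: sum_distrib_left sum_distrib_right of_center_sum)
  also have "\<dots> = (\<Sum>j\<in>UNIV. if i = j then g j else 0)"
    unfolding C_def sum_cofactor_row
    by (intro sum.cong refl) (simp add: mult.commute[of "det N'"] dets zero_center.rep_eq one_center.rep_eq)
  also have "\<dots> = g i" by simp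
  finally show ?thesis by (simp add: inv ncofactor)
qed

section \<open>The chain rule\<close>

lemma even_proj_even_mult: "even_proj a = a \<Longrightarrow> even_proj (a * b) = a * even_proj b"
  by (simp add: even_proj_mult)

lemma pderiv_odd_even: "even_proj a = 0 \<Longrightarrow> even_proj (pderiv j a) = pderiv j a"
  by (simp add: even_proj_pderiv)

text \<open>Each \<open>\<sigma> (gen i)\<close> is odd, so it produces the same Leibniz sign as
  \<open>gen i\<close>; the Jacobian entries are even, so \<open>\<sigma> (gen i)\<close> can be
  moved past them.\<close>

lemma chain_rule:
  fixes \<sigma> :: "('n::finite, 'k::comm_ring_1) grassmann \<Rightarrow> ('n, 'k) grassmann"
  assumes \<sigma>: "alg_automorphism \<sigma>" and odd: "\<And>i. even_proj (\<sigma> (gen i)) = 0"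
  shows "pderiv k (\<sigma> b) = (\<Sum>j\<in>UNIV. pderiv k (\<sigma> (gen j)) * \<sigma> (pderiv j b))"
proof -
  interpret \<sigma>: module_hom gscale gscale \<sigma>
    using \<sigma> by (simp add: alg_automorphism_def)
  have mult: "\<sigma> (a * b) = \<sigma> a * \<sigma> b" for a b
    using \<sigma> by (simp add: alg_automorphism_def)
  have central: "\<sigma> (gen i) * (pderiv k (\<sigma> (gen j)) * c) = pderiv k (\<sigma> (gen j)) * (\<sigma> (gen i) * c)" for i j c
    using even_central[OF pderiv_odd_even[OF odd], of k j "\<sigma> (gen i)"] by (simp flip: mult.assoc)
  show ?thesis
  proof (induction b rule: grassmann_induct)
    case one
    show ?case using \<sigma> by (simp add: alg_automorphism_def \<sigma>.zero)
  next
    case (gen i b)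
    have "pderiv k (\<sigma> (gen i * b)) = pderiv k (\<sigma> (gen i)) * \<sigma> b
        - (\<Sum>j\<in>UNIV. pderiv k (\<sigma> (gen j)) * \<sigma> (gen i * pderiv j b))"
      by (simp add: mult pderiv_odd_mult odd gen.IH sum_distrib_left central)
    also have "\<dots> = (\<Sum>j\<in>UNIV. pderiv k (\<sigma> (gen j)) * \<sigma> (pderiv j (gen i * b)))"
      by (simp add: pderiv_gen_mult \<sigma>.diff right_diff_distrib sum_subtractf if_distrib[of \<sigma>] \<sigma>.zero
          if_distrib[of "(*) _"] cong: if_cong)
    finally show ?case .
  qed (simp_all add: \<sigma>.add \<sigma>.scale distrib_left sum.distrib gscale_mult_right grassmann.scale_sum_right)
qed

lemma deriv'_automorphism:
  fixes \<sigma> :: "('n::{finite,linorder}, 'k::comm_ring_1) grassmann \<Rightarrow> ('n, 'k) grassmann"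
  assumes \<sigma>: "alg_automorphism \<sigma>" and odd: "\<And>i. even_proj (\<sigma> (gen i)) = 0"
  shows "deriv' \<sigma> i (\<sigma> b) = \<sigma> (pderiv i b)"
proof -
  \<comment> \<open>The chain rule at \<open>b = inv \<sigma> (gen l)\<close> suggests this inverse.
    Taking even parts makes its entries central without a parity statement about
    \<open>inv \<sigma>\<close>; the identity survives since the Jacobian entries and the Kronecker
    delta are even.\<close>
  let ?N = "\<chi> j l. even_proj (\<sigma> (pderiv j (inv \<sigma> (gen l))))"
  have bij: "bij \<sigma>"
    using \<sigma> by (simp add: alg_automorphism_def)
  have entry: "jacobian \<sigma> $ j $ k = pderiv k (\<sigma> (gen j))" for j k
    by (simp add: jacobian_def skew_deriv_eq_pderiv)
  have entry_even: "even_proj (jacobian \<sigma> $ j $ k) = jacobian \<sigma> $ j $ k" for j k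
    by (simp add: entry pderiv_odd_even odd)
  show ?thesis
    unfolding deriv'_def skew_deriv_eq_pderiv
  proof (rule central_cramer[where N = ?N])
    show "jacobian \<sigma> $ j $ k * a = a * jacobian \<sigma> $ j $ k" for j k a
      by (rule even_central) (rule entry_even)
    show "?N $ j $ l * a = a * ?N $ j $ l" for j l a
      by (rule even_central) (simp add: even_proj_idem)
    show "pderiv k (\<sigma> b) = (\<Sum>j\<in>UNIV. jacobian \<sigma> $ j $ k * \<sigma> (pderiv j b))" for k
      unfolding entry by (rule chain_rule[OF \<sigma> odd])
    fix k l
    have "(\<Sum>j\<in>UNIV. jacobian \<sigma> $ j $ k * ?N $ j $ l)
        = even_proj (\<Sum>j\<in>UNIV. jacobian \<sigma> $ j $ k * \<sigma> (pderiv j (inv \<sigma> (gen l))))"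
      by (simp add: even_proj_even_mult[OF entry_even])
    also have "\<dots> = even_proj (pderiv k (gen l))"
      unfolding entry chain_rule[OF \<sigma> odd, symmetric] using bij by (simp add: bij_is_surj surj_f_inv_f)
    finally show "(\<Sum>j\<in>UNIV. jacobian \<sigma> $ j $ k * ?N $ j $ l) = (if k = l then 1 else 0)"
      by (simp add: pderiv_gen)
  qed
qed

text \<open>\<open>\<gamma> (gen j)\<close> is odd because it differs from \<open>gen j\<close> by
  an odd element, and \<open>\<tau> (gen i)\<close> is a linear combination of generators.\<close>

lemma Gamma_GL_op_automorphism:
  assumes "\<sigma> \<in> Gamma_GL_op"
  shows "alg_automorphism \<sigma>" "even_proj (\<sigma> (gen i)) = 0"
proof -
  obtain \<gamma> \<tau> where \<sigma>: "\<sigma> = \<gamma> \<circ> \<tau>" and \<gamma>: "\<gamma> \<in> Gamma" and \<tau>: "\<tau> \<in> GL_op"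
    using assms by (auto simp: Gamma_GL_op_def)
  have auts: "alg_automorphism \<gamma>" "alg_automorphism \<tau>"
    using \<gamma> \<tau> by (simp_all add: Gamma_def GL_op_def)
  then show "alg_automorphism \<sigma>"
    by (auto simp: alg_automorphism_def \<sigma> bij_comp intro: module_hom_compose)
  interpret \<gamma>: module_hom gscale gscale \<gamma>
    using auts by (simp add: alg_automorphism_def)
  have "even_proj (\<gamma> (gen j)) = 0" for j
    using \<gamma> odd_part_even_proj[of "\<gamma> (gen j) - gen j"] by (simp add: Gamma_def)
  moreover obtain A where "\<tau> (gen i) = (\<Sum>j\<in>UNIV. gscale (A $ i $ j) (gen j))"
    using \<tau> by (auto simp: GL_op_def)
  ultimately show "even_proj (\<sigma> (gen i)) = 0"
    by (simp add: \<sigma> \<gamma>.sum \<gamma>.scale)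
qed

section \<open>Coefficients with respect to the monomial basis\<close>

lemma gen_mult_gword_eq_0: "i \<in> set w \<Longrightarrow> gen i * gword w = (0 :: ('n, 'k::comm_ring_1) grassmann)"
proof (induction w)
  case (Cons j w)
  show ?case
  proof (cases "i = j")
    case True
    then show ?thesis by (simp add: gen_square flip: mult.assoc)
  next
    case False
    then have "gen i * gword (j # w) = - (gen j * (gen i * gword w) :: ('n, 'k) grassmann)"
      by (simp add: gen_anticomm[of i j] flip: mult.assoc)
    then show ?thesis using Cons False by simp
  qed
qed simp

text \<open>Moving \<open>gen i\<close> into its sorted place only costs a sign, absorbed in
  \<open>c\<close>.\<close>

lemma gen_mult_gword_insort:
  "\<exists>c. gen i * gword w = gscale c (gword (insort i w) :: ('n::linorder, 'k::comm_ring_1) grassmann)"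
proof (induction w)
  case Nil
  show ?case by (intro exI[of _ 1]) simp
next
  case (Cons j w)
  then obtain c where c: "gen i * gword w = gscale c (gword (insort i w) :: ('n, 'k) grassmann)"
    by blast
  show ?case
  proof (cases "i \<le> j")
    case True
    then show ?thesis by (intro exI[of _ 1]) simp
  next
    case False
    have "gen i * gword (j # w) = - (gen j * (gen i * gword w) :: ('n, 'k) grassmann)"
      using False by (simp add: gen_anticomm[of i j] flip: mult.assoc)
    then show ?thesis
      using False by (intro exI[of _ "- c"]) (simp add: c gscale_mult_right)
  qed
qed

text \<open>The span is closed under left multiplication by \<open>gen i\<close>: a repeated letter
  kills the monomial, a new one is sorted in.\<close>

lemma gen_pow_span: "(a :: ('n::{finite,linorder}, 'k::comm_ring_1) grassmann) \<in> gspan (range gen_pow)"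
proof (induction a rule: grassmann_induct)
  case one
  show ?case
    by (intro grassmann.span_base) (auto simp: gen_pow_def intro!: image_eqI[of _ _ "{}"])
next
  case (gen i a)
  have step: "gen i * gen_pow \<alpha> \<in> gspan (range gen_pow :: ('n, 'k) grassmann set)" for \<alpha>
  proof (cases "i \<in> \<alpha>")
    case True
    then show ?thesis
      by (simp add: gen_pow_def gen_mult_gword_eq_0 grassmann.span_zero)
  next
    case False
    obtain c where "gen i * gen_pow \<alpha>
        = gscale c (gword (insort i (sorted_list_of_set \<alpha>)) :: ('n, 'k) grassmann)"
      using gen_mult_gword_insort unfolding gen_pow_def by blast
    also have "gword (insort i (sorted_list_of_set \<alpha>)) = gen_pow (insert i \<alpha>)"
      using False by (simp add: gen_pow_def)
    finally show ?thesis
      by (simp add: grassmann.span_scale grassmann.span_base)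
  qed
  from gen show ?case
  proof (induction rule: grassmann.span_induct_alt)
    case base
    show ?case by (simp add: grassmann.span_zero)
  next
    case (step c x y)
    with \<open>\<And>\<alpha>. gen i * gen_pow \<alpha> \<in> gspan (range gen_pow)\<close> show ?case
      by (auto simp: distrib_left gscale_mult_right intro!: grassmann.span_add grassmann.span_scale)
  qed
qed (simp_all add: grassmann.span_add grassmann.span_scale)

section \<open>Derivations acting on monomials\<close>

lemma pderiv_gword_eq_0: "j \<notin> set w \<Longrightarrow> pderiv j (gword w) = 0"
  by (induction w) (auto simp: pderiv_gen_mult)

lemma gen_mult_pderiv_gword:
  assumes "distinct w" "j \<in> set w"
  shows "gen j * pderiv j (gword w) = (gword w :: ('n, 'k::comm_ring_1) grassmann)"
  using assms
proof (induction w)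
  case (Cons i w)
  show ?case
  proof (cases "j = i")
    case True
    then show ?thesis using Cons.prems by (simp add: pderiv_gen_mult pderiv_gword_eq_0)
  next
    case False
    then have "gen j * pderiv j (gword (i # w)) = gen i * (gen j * pderiv j (gword w) :: ('n, 'k) grassmann)"
      by (simp add: pderiv_gen_mult gen_anticomm[of j i] flip: mult.assoc)
    then show ?thesis using Cons False by simp
  qed
qed simp

lemma module_hom_fold:
  assumes "\<And>x. module_hom gscale gscale (f x)"
  shows "module_hom gscale gscale (fold f xs)"
proof (induction xs)
  case Nil
  show ?case using grassmann.module_hom_ident by simp
next
  case (Cons x xs)
  then show ?case
    using module_hom_compose[OF assms[of x] Cons.IH] by (simp add: o_def)
qed

text \<open>The untwisted counterpart of \<open>phi\<close>. The factor for \<open>i\<close> removes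
  the monomials containing \<open>gen i\<close> and fixes the others, so over all indices only the
  constant term is left.\<close>

definition const_part :: "'n list \<Rightarrow> ('n, 'k::comm_ring_1) grassmann \<Rightarrow> ('n, 'k) grassmann"
  where "const_part = fold (\<lambda>i a. a - gen i * pderiv i a)"

lemma module_hom_const_part: "module_hom gscale gscale (const_part xs)"
  unfolding const_part_def
  by (intro module_hom_fold module_hom.intro module_hom_axioms.intro grassmann.module_axioms)
    (simp_all add: algebra_simps gscale_mult_right flip: grassmann.scale_right_diff_distrib)

lemmas const_part_simps [simp] =
  module_hom.scale[OF module_hom_const_part] module_hom.zero[OF module_hom_const_part]

lemma const_part_gword:
  assumes "distinct w"
  shows "const_part xs (gword w) = (if set xs \<inter> set w = {} then gword w else 0)"
  using assms
proof (induction xs)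
  case (Cons i xs)
  then show ?case
    using module_hom.zero[OF module_hom_const_part, of xs]
    by (cases "i \<in> set w") (simp_all add: const_part_def gen_mult_pderiv_gword pderiv_gword_eq_0)
qed (simp add: const_part_def)

lemma pderiv_gword_removeAll:
  assumes "distinct w"
  shows "\<exists>c. pderiv j (gword w) = gscale c (gword (removeAll j w) :: ('n, 'k::comm_ring_1) grassmann)"
  using assms
proof (induction w)
  case Nil
  show ?case by (intro exI[of _ 0]) simp
next
  case (Cons i w)
  then obtain c where c: "pderiv j (gword w) = gscale c (gword (removeAll j w) :: ('n, 'k) grassmann)"
    by auto
  show ?case
  proof (cases "j = i")
    case True
    then show ?thesis
      using Cons.prems by (intro exI[of _ 1]) (simp add: pderiv_gen_mult pderiv_gword_eq_0)
  next
    case False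
    then show ?thesis
      by (intro exI[of _ "- c"]) (simp add: pderiv_gen_mult c gscale_mult_right)
  qed
qed

lemmas fold_pderiv_simps [simp] =
  module_hom.scale[OF module_hom_fold[OF module_hom_pderiv]]
  module_hom.zero[OF module_hom_fold[OF module_hom_pderiv]]

text \<open>Signs are not tracked. Differentiating by an absent letter gives \<open>c = 0\<close>;
  otherwise the filtered word lists the letters left over, which decides whether
  \<open>const_part\<close> kills the result.\<close>

lemma fold_pderiv_gword:
  assumes "distinct w"
  shows "\<exists>c. fold pderiv xs (gword w)
      = gscale c (gword (filter (\<lambda>i. i \<notin> set xs) w) :: ('n, 'k::comm_ring_1) grassmann)
    \<and> (c = 0 \<or> set xs \<subseteq> set w)"
  using assms
proof (induction xs arbitrary: w)
  case Nil
  show ?case by (intro exI[of _ 1]) simp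
next
  case (Cons j xs)
  show ?case
  proof (cases "j \<in> set w")
    case False
    then show ?thesis
      by (intro exI[of _ 0]) (simp add: pderiv_gword_eq_0)
  next
    case True
    obtain c where c: "pderiv j (gword w) = gscale c (gword (removeAll j w) :: ('n, 'k) grassmann)"
      using pderiv_gword_removeAll[OF Cons.prems] by blast
    obtain d where d: "fold pderiv xs (gword (removeAll j w))
        = gscale d (gword (filter (\<lambda>i. i \<notin> set xs) (removeAll j w)) :: ('n, 'k) grassmann)"
      "d = 0 \<or> set xs \<subseteq> set (removeAll j w)"
      using Cons.IH[of "removeAll j w"] Cons.prems by (auto simp: distinct_removeAll)
    have "filter (\<lambda>i. i \<notin> set xs) (removeAll j w) = filter (\<lambda>i. i \<notin> set (j # xs)) w"
      by (simp add: removeAll_filter_not_eq conj_commute eq_commute)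
    with d True show ?thesis
      by (intro exI[of _ "c * d"]) (auto simp: c)
  qed
qed

text \<open>Each derivation meets its own letter at the front of the remaining word, so no sign
  arises; this is why the derivations are applied in the order of the letters.\<close>

lemma fold_pderiv_gword_self: "distinct w \<Longrightarrow> fold pderiv w (gword w) = 1"
  by (induction w) (simp_all add: pderiv_gen_mult pderiv_gword_eq_0)

lemma coefficient_gen_pow:
  fixes \<alpha> \<beta> :: "'n::{finite,linorder} set"
  shows "const_part (sorted_list_of_set UNIV) (fold pderiv (sorted_list_of_set \<alpha>) (gen_pow \<beta>))
    = (if \<alpha> = \<beta> then 1 else (0 :: ('n, 'k::comm_ring_1) grassmann))"
proof (cases "\<alpha> = \<beta>")
  case True
  then show ?thesis
    using const_part_gword[of "[]" "sorted_list_of_set UNIV"]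
    by (simp add: gen_pow_def fold_pderiv_gword_self)
next
  case False
  let ?v = "filter (\<lambda>i. i \<notin> \<alpha>) (sorted_list_of_set \<beta>)"
  obtain c where c: "fold pderiv (sorted_list_of_set \<alpha>) (gen_pow \<beta>) = gscale c (gword ?v :: ('n, 'k) grassmann)"
    "c = 0 \<or> \<alpha> \<subseteq> \<beta>"
    using fold_pderiv_gword[of "sorted_list_of_set \<beta>" "sorted_list_of_set \<alpha>"] by (auto simp: gen_pow_def)
  \<comment> \<open>If \<alpha> is a proper subset of \<beta>, a letter of \<beta> outside \<alpha>
    remains.\<close>
  have "c = 0 \<or> set ?v \<noteq> {}"
    using c(2) False by auto
  then show ?thesis
    using False by (auto simp: c(1) const_part_gword simp del: set_filter)
qed

theorem theorem3p1:
  fixes \<sigma> :: "('n::{finite,linorder}, 'k::comm_ring_1) grassmann \<Rightarrow> ('n, 'k) grassmann"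
    and a :: "('n, 'k) grassmann"
  assumes "\<sigma> \<in> Gamma_GL_op"
  shows "inv \<sigma> a = (\<Sum>\<alpha>\<in>Pow UNIV. phi \<sigma> (deriv'_pow \<sigma> \<alpha> a) * gen_pow \<alpha>)"
proof -
  note aut = Gamma_GL_op_automorphism[OF assms]
  interpret \<sigma>: module_hom gscale gscale \<sigma>
    using aut(1) by (simp add: alg_automorphism_def)
  have mult: "\<sigma> (x * y) = \<sigma> x * \<sigma> y" and one: "\<sigma> 1 = 1" and bij: "bij \<sigma>" for x y
    using aut(1) by (simp_all add: alg_automorphism_def)
  note deriv' = deriv'_automorphism[OF aut]
  let ?R = "const_part (sorted_list_of_set (UNIV :: 'n set)) :: ('n, 'k) grassmann \<Rightarrow> ('n, 'k) grassmann"
  let ?D = "\<lambda>\<alpha>. fold pderiv (sorted_list_of_set \<alpha>) :: ('n, 'k) grassmann \<Rightarrow> ('n, 'k) grassmann"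
  \<comment> \<open>The intertwining relation for one \<open>deriv'\<close> passes along the whole
    composition; the same happens for \<open>phi\<close> below.\<close>
  have pow: "deriv'_pow \<sigma> \<alpha> (\<sigma> b) = \<sigma> (?D \<alpha> b)" for \<alpha> b
  proof -
    have "fold (deriv' \<sigma>) xs (\<sigma> b) = \<sigma> (fold pderiv xs b)" for xs
      by (induction xs arbitrary: b) (simp_all add: deriv')
    then show ?thesis by (simp add: deriv'_pow_def)
  qed
  have phi: "phi \<sigma> (\<sigma> b) = \<sigma> (?R b)" for b
  proof -
    have "fold (\<lambda>i a. a - \<sigma> (gen i) * deriv' \<sigma> i a) xs (\<sigma> b)
        = \<sigma> (fold (\<lambda>i a. a - gen i * pderiv i a) xs b)" for xs
      by (induction xs arbitrary: b) (simp_all add: deriv' flip: mult \<sigma>.diff)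
    then show ?thesis by (simp add: phi_def const_part_def)
  qed
  \<comment> \<open>By linearity it suffices to test monomials, whose coefficients are 0 or 1 and
    hence fixed by \<sigma>.\<close>
  have expand: "(\<Sum>\<alpha>\<in>Pow UNIV. \<sigma> (?R (?D \<alpha> b)) * gen_pow \<alpha>) = b" for b
    using gen_pow_span[of b]
  proof (induction rule: grassmann.span_induct_alt)
    case base
    show ?case by (simp add: \<sigma>.zero)
  next
    case (step c x y)
    obtain \<beta> where x: "x = gen_pow \<beta>"
      using step(1) by blast
    have "\<sigma> (?R (?D \<alpha> x)) * gen_pow \<alpha> = (if \<alpha> = \<beta> then x else 0)" for \<alpha>
      unfolding x coefficient_gen_pow by (simp add: one \<sigma>.zero)
    then have "\<sigma> (?R (?D \<alpha> (gscale c x + y))) * gen_pow \<alpha>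
        = (if \<alpha> = \<beta> then gscale c x else 0) + \<sigma> (?R (?D \<alpha> y)) * gen_pow \<alpha>" for \<alpha>
      by (simp add: module_hom.add[OF module_hom_const_part]
          module_hom.add[OF module_hom_fold[OF module_hom_pderiv]] \<sigma>.add \<sigma>.scale distrib_right gscale_mult_left)
    then show ?case
      using step by (simp add: sum.distrib)
  qed
  \<comment> \<open>\<open>pow\<close> and \<open>phi\<close> evaluate the operators on values of
    \<sigma>, so \<open>a\<close> is written as one; \<open>expand\<close> is then applied to
    \<open>inv \<sigma> a\<close>.\<close>
  have "a = \<sigma> (inv \<sigma> a)"
    using bij by (simp add: bij_is_surj surj_f_inv_f)
  then have "phi \<sigma> (deriv'_pow \<sigma> \<alpha> a) = \<sigma> (?R (?D \<alpha> (inv \<sigma> a)))" for \<alpha>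
    using pow phi by metis
  then show ?thesis
    by (simp only: expand)
qed

end
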